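(* Let $A\in\mathbb{C}^{n\times n}$ be a Hermitian $J$-symmetric matrix and let $m\ge 1$. Let $V_{m+1}=[v_1,\dots,v_{m+1}]$ be the $m$-step Lanczos vectors for $A$ generated with a unit vector $v_1\in\mathbb{C}^n$, where no breakdown occurs. Let $W_{m+1}=J V_{m+1}^{*}$. Then $$V_{m+1}^{H}W_{m+1}=O,\qquad V_{m+1}^{H}AW_{m+1}=O.$$
   Context: Notation: $^{T}$ is the matrix transpose, $^{H}$ the Hermitian conjugate (conjugate transpose), $^{*}$ the entrywise complex conjugate, and $O$ a null matrix of appropriate size. Let $J\in\mathbb{R}^{n\times n}$ satisfy $J^{T}=-J$ and $J^{T}=J^{-1}$. A matrix $A\in\mathbb{C}^{n\times n}$ is called $J$-symmetric if $JAJ^{-1}=A^{T}$; it is Hermitian $J$-symmetric if in addition $A^{H}=A$. Lanczos vectors: the $m$-step Lanczos iteration for $A$ started with the unit vector $v_1$ produces vectors $v_1,\dots,v_{m+1}\in\mathbb{C}^n$ with $V_{m+1}^{H}V_{m+1}=I$, and real numbers $\alpha_1,\dots,\alpha_m$, $\beta_1,\dots,\beta_m$, satisfying the Lanczos decomposition $$A V_m = V_m T_m + \beta_m v_{m+1}e_m^{T},$$ where $V_m=[v_1,\dots,v_m]$, $e_m$ is the $m$-dimensional unit vector in the $m$-th direction, and $T_m$ is the real symmetric tridiagonal $m\times m$ matrix with diagonal entries $\alpha_1,\dots,\alpha_m$ and off-diagonal entries $\beta_1,\dots,\beta_{m-1}$ (that is, $(T_m)_{j,j+1}=(T_m)_{j+1,j}=\beta_j$).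 "No breakdown occurs" means $\beta_j\neq 0$ for all $j=1,\dots,m$. *)

theory Defs
  imports "Jordan_Normal_Form.Schur_Decomposition"
begin

abbreviation complex_mat :: "real mat \<Rightarrow> complex mat" where
  "complex_mat \<equiv> map_mat complex_of_real"

definition structure_mat :: "nat \<Rightarrow> real mat \<Rightarrow> bool" where
  "structure_mat n J \<longleftrightarrow>
     J \<in> carrier_mat n n \<and> transpose_mat J = - J \<and> mat_inverse J = Some (transpose_mat J)"

definition J_symmetric :: "nat \<Rightarrow> real mat \<Rightarrow> complex mat \<Rightarrow> bool" where
  "J_symmetric n J A \<longleftrightarrow> A \<in> carrier_mat n n \<and>
     (\<exists>K. mat_inverse J = Some K \<and> complex_mat J * A * complex_mat K = transpose_mat A)"

definition hermitian_J_symmetric :: "nat \<Rightarrow> real mat \<Rightarrow> complex mat \<Rightarrow> bool" where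
  "hermitian_J_symmetric n J A \<longleftrightarrow> J_symmetric n J A \<and> mat_adjoint A = A"

text \<open>The families \<open>v\<close>, \<open>\<alpha>\<close> and \<open>\<beta>\<close> below are indexed from 1 (their values at 0 are irrelevant),
  whereas matrix entries are indexed from 0.\<close>

definition lanczos_basis :: "nat \<Rightarrow> (nat \<Rightarrow> complex vec) \<Rightarrow> nat \<Rightarrow> complex mat" where
  "lanczos_basis n v k = mat_of_cols n (map v [1..<k + 1])"

definition lanczos_tridiag :: "(nat \<Rightarrow> real) \<Rightarrow> (nat \<Rightarrow> real) \<Rightarrow> nat \<Rightarrow> real mat" where
  "lanczos_tridiag \<alpha> \<beta> m = mat m m (\<lambda>(i, j).
     if i = j then \<alpha> (i + 1)
     else if j = i + 1 then \<beta> (i + 1)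
     else if i = j + 1 then \<beta> (j + 1)
     else 0)"

text \<open>The term \<open>\<beta>\<^sub>m v\<^sub>m\<^sub>+\<^sub>1 e\<^sub>m\<^sup>T\<close> is the product of an \<open>n \<times> 1\<close> and a \<open>1 \<times> m\<close> matrix;
  \<open>e\<^sub>m\<close> is \<open>unit_vec m (m - 1)\<close> because of the indexing from 0.\<close>

definition lanczos ::
  "nat \<Rightarrow> complex mat \<Rightarrow> nat \<Rightarrow> complex vec \<Rightarrow> (nat \<Rightarrow> complex vec) \<Rightarrow> (nat \<Rightarrow> real) \<Rightarrow> (nat \<Rightarrow> real) \<Rightarrow> bool"
where
  "lanczos n A m v1 v \<alpha> \<beta> \<longleftrightarrow>
     v 1 = v1 \<and>
     (\<forall>i\<in>{1..m + 1}. v i \<in> carrier_vec n) \<and>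
     mat_adjoint (lanczos_basis n v (m + 1)) * lanczos_basis n v (m + 1) = 1\<^sub>m (m + 1) \<and>
     A * lanczos_basis n v m =
       lanczos_basis n v m * complex_mat (lanczos_tridiag \<alpha> \<beta> m)
       + complex_of_real (\<beta> m) \<cdot>\<^sub>m (mat_of_cols n [v (m + 1)] * mat_of_rows m [unit_vec m (m - 1)])"

definition no_breakdown :: "nat \<Rightarrow> (nat \<Rightarrow> real) \<Rightarrow> bool" where
  "no_breakdown m \<beta> \<longleftrightarrow> (\<forall>j\<in>{1..m}. \<beta> j \<noteq> 0)"

end

theory Submission
  imports Defs
begin

text \<open>
  The matrix \<open>J\<close> defines a skew-symmetric bilinear form \<open>B x y = x \<bullet> J y\<close> on complex vectors
  (bilinear, not sesquilinear). Entry \<open>(i, j)\<close> of \<open>V\<^sup>H J V\<^sup>*\<close> is the complex conjugate of \<open>B\<close> at columns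
  \<open>i\<close> and \<open>j\<close> of \<open>V\<close> (lemma \<open>adjoint_mult_real_mult_cnj\<close>), and since \<open>A\<close> is Hermitian, \<open>V\<^sup>H A W = (A V)\<^sup>H W\<close>
  has the same form, with the columns of \<open>A V\<close> on the left. So both claims say that \<open>B\<close> vanishes on
  certain pairs of vectors.

  Now \<open>J\<close>-symmetry, written as \<open>J A = A\<^sup>T J\<close>, says that \<open>A\<close> is self-adjoint for \<open>B\<close>. Therefore
  \<open>B (A\<^sup>k v) (A\<^sup>l v) = B v (A\<^sup>k\<^sup>+\<^sup>l v) = B (A\<^sup>k\<^sup>+\<^sup>l v) v\<close>, and skew symmetry makes this number equal to its own
  negative. Hence \<open>B\<close> vanishes on the whole Krylov space of \<open>v\<close> (lemma \<open>krylov_space_isotropic\<close>).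
  The columns of \<open>V\<close> are the Lanczos vectors, which belong to the Krylov space of the starting
  vector because the three-term recurrence can be solved for its newest vector when no \<open>\<beta>\<^sub>j\<close> is zero
  (lemma \<open>lanczos_in_krylov_space\<close>). The columns of \<open>A V\<close> belong to it by invariance under \<open>A\<close>.
\<close>

section \<open>Isotropy of Krylov spaces\<close>

text \<open>The full Krylov space, the vectors \<open>p(A) v\<close> for polynomials \<open>p\<close>, given as the smallest
  \<open>A\<close>-invariant subspace that contains \<open>v\<close>: membership of the Lanczos vectors and vanishing of a
  bilinear form then both follow by the closure rules, without any polynomials.\<close>

inductive_set krylov_space :: "'a::comm_ring_1 mat \<Rightarrow> 'a vec \<Rightarrow> 'a vec set"
  for A :: "'a mat" and v :: "'a vec" where
  start: "v \<in> krylov_space A v"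
| mult: "x \<in> krylov_space A v \<Longrightarrow> A *\<^sub>v x \<in> krylov_space A v"
| add: "x \<in> krylov_space A v \<Longrightarrow> y \<in> krylov_space A v \<Longrightarrow> x + y \<in> krylov_space A v"
| smult: "x \<in> krylov_space A v \<Longrightarrow> c \<cdot>\<^sub>v x \<in> krylov_space A v"

lemma krylov_space_carrier:
  assumes "A \<in> carrier_mat n n" "v \<in> carrier_vec n" "x \<in> krylov_space A v"
  shows "x \<in> carrier_vec n"
  using assms(3) by induction (use assms(1,2) in auto)

lemma scalar_prod_transpose_mult:
  fixes M :: "'a::comm_ring_1 mat"
  assumes "M \<in> carrier_mat n n" "x \<in> carrier_vec n" "y \<in> carrier_vec n"
  shows "x \<bullet> (M *\<^sub>v y) = (M\<^sup>T *\<^sub>v x) \<bullet> y"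
  using assms transpose_vec_mult_scalar[of M n n y x]
  by (metis comm_scalar_prod mult_mat_vec_carrier transpose_carrier_mat)

text \<open>Moving \<open>J\<close> past \<open>A\<close> turns \<open>A\<close> into its transpose, which the bilinear scalar product carries
  back to \<open>A\<close> on the other side.\<close>

lemma bilinear_form_selfadjoint:
  fixes A J :: "'a::comm_ring_1 mat"
  assumes A: "A \<in> carrier_mat n n" and J: "J \<in> carrier_mat n n"
    and JA: "J * A = A\<^sup>T * J"
    and x: "x \<in> carrier_vec n" and y: "y \<in> carrier_vec n"
  shows "(A *\<^sub>v x) \<bullet> (J *\<^sub>v y) = x \<bullet> (J *\<^sub>v (A *\<^sub>v y))"
proof -
  have "x \<bullet> (J *\<^sub>v (A *\<^sub>v y)) = x \<bullet> (A\<^sup>T *\<^sub>v (J *\<^sub>v y))"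
    using A J JA y by (metis assoc_mult_mat_vec transpose_carrier_mat)
  also have "\<dots> = (A *\<^sub>v x) \<bullet> (J *\<^sub>v y)"
    using scalar_prod_transpose_mult[of "A\<^sup>T" n x "J *\<^sub>v y"] A J x y by simp
  finally show ?thesis by simp
qed

lemma bilinear_form_skew:
  fixes J :: "'a::comm_ring_1 mat"
  assumes J: "J \<in> carrier_mat n n" and skew: "J\<^sup>T = - J"
    and x: "x \<in> carrier_vec n" and y: "y \<in> carrier_vec n"
  shows "x \<bullet> (J *\<^sub>v y) = - (y \<bullet> (J *\<^sub>v x))"
proof -
  have "x \<bullet> (J *\<^sub>v y) = (- J *\<^sub>v x) \<bullet> y"
    using scalar_prod_transpose_mult[OF J x y] skew by simp
  also have "- J *\<^sub>v x = - (J *\<^sub>v x)"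
    using J x by (intro eq_vecI) auto
  also have "(- (J *\<^sub>v x)) \<bullet> y = - ((J *\<^sub>v x) \<bullet> y)"
    using J x y by (simp add: scalar_prod_def sum_negf)
  also have "(J *\<^sub>v x) \<bullet> y = y \<bullet> (J *\<^sub>v x)"
    using J x y by (intro comm_scalar_prod) auto
  finally show ?thesis .
qed

text \<open>On the powers \<open>A\<^sup>k v\<close> the form is both symmetric, by self-adjointness, and skew. The vanishing
  extends to the span in one argument after the other. The right argument comes first, against all
  powers \<open>A\<^sup>k v\<close> at once, since shifting \<open>A\<close> to the left raises \<open>k\<close>.\<close>

lemma krylov_space_isotropic:
  fixes A J :: "complex mat"
  assumes A: "A \<in> carrier_mat n n" and J: "J \<in> carrier_mat n n"
    and skew: "J\<^sup>T = - J" and JA: "J * A = A\<^sup>T * J" and v: "v \<in> carrier_vec n"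
    and x: "x \<in> krylov_space A v" and y: "y \<in> krylov_space A v"
  shows "x \<bullet> (J *\<^sub>v y) = 0"
proof -
  define P where "P k = ((*\<^sub>v) A ^^ k) v" for k
  have P_carrier: "P k \<in> carrier_vec n" for k
    unfolding P_def using A v by (induction k) auto
  have P_0: "P 0 = v" and P_Suc: "P (Suc k) = A *\<^sub>v P k" for k
    by (simp_all add: P_def)
  note K = krylov_space_carrier[OF A v]
  note adj = bilinear_form_selfadjoint[OF A J JA]
  have shift: "P k \<bullet> (J *\<^sub>v P l) = v \<bullet> (J *\<^sub>v P (k + l))" for k l
  proof (induction k arbitrary: l)
    case 0
    show ?case by (simp add: P_0)
  next
    case (Suc k)
    have "P (Suc k) \<bullet> (J *\<^sub>v P l) = P k \<bullet> (J *\<^sub>v P (Suc l))"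
      by (simp add: P_Suc adj P_carrier)
    then show ?case using Suc.IH[of "Suc l"] by simp
  qed
  have power_start: "P k \<bullet> (J *\<^sub>v v) = 0" for k
  proof -
    have "P k \<bullet> (J *\<^sub>v v) = v \<bullet> (J *\<^sub>v P k)"
      using shift[of k 0] by (simp add: P_0)
    also have "\<dots> = - (P k \<bullet> (J *\<^sub>v v))"
      by (rule bilinear_form_skew[OF J skew v P_carrier])
    \<comment> \<open>A complex number that equals its negative is zero; this needs characteristic other than 2.\<close>
    finally show ?thesis by simp
  qed
  have power: "P k \<bullet> (J *\<^sub>v z) = 0" if "z \<in> krylov_space A v" for z k
    using that
  proof (induction arbitrary: k)
    case start
    show ?case by (rule power_start)
  next
    case (mult z)
    show ?case
      using mult.IH[of "Suc k"] adj[OF P_carrier K[OF mult.hyps]] by (simp add: P_Suc)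
  next
    case (add z w)
    then show ?case
      using J P_carrier[of k] K[OF add.hyps(1)] K[OF add.hyps(2)]
      by (simp add: mult_add_distrib_mat_vec[of _ n n] scalar_prod_add_distrib[of _ n])
  next
    case (smult z c)
    then show ?case
      using J P_carrier[of k] K[OF smult.hyps] by (simp add: mult_mat_vec[of _ n n])
  qed
  show ?thesis
    using x y
  proof (induction arbitrary: y)
    case start
    then show ?case using power[of y 0] by (simp add: P_0)
  next
    case (mult z)
    show ?case
      using mult.IH[OF krylov_space.mult[OF mult.prems]] adj[OF K[OF mult.hyps] K[OF mult.prems]]
      by simp
  next
    case (add z w)
    then show ?case
      using J K[OF add.hyps(1)] K[OF add.hyps(2)] K[OF add.prems]
      by (simp add: add_scalar_prod_distrib[of _ n])
  next
    case (smult z c)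
    then show ?case
      using J K[OF smult.hyps] K[OF smult.prems] by simp
  qed
qed

section \<open>The Lanczos vectors\<close>

lemma lanczos_basis_carrier: "lanczos_basis n v k \<in> carrier_mat n k"
  by (simp add: lanczos_basis_def mat_of_cols_def del: upt_Suc)

lemma col_lanczos_basis:
  assumes "j < k" "v (Suc j) \<in> carrier_vec n"
  shows "col (lanczos_basis n v k) j = v (Suc j)"
proof -
  have "j < length (map v [1..<k + 1])" "map v [1..<k + 1] ! j = v (Suc j)"
    using assms(1) by (auto simp del: upt_Suc)
  with assms(2) show ?thesis
    unfolding lanczos_basis_def by (metis col_mat_of_cols)
qed

text \<open>Column \<open>j\<close> (counted from 0) of the Lanczos decomposition. The rank-one term supplies the vector
  \<open>v\<^sub>m\<^sub>+\<^sub>1\<close> in the last column, where the tridiagonal matrix has no subdiagonal entry; this is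
  why one formula covers all columns.\<close>

lemma lanczos_three_term:
  assumes A: "A \<in> carrier_mat n n" and L: "lanczos n A m v1 v \<alpha> \<beta>" and j: "j < m"
  shows "A *\<^sub>v v (Suc j) = complex_of_real (\<alpha> (Suc j)) \<cdot>\<^sub>v v (Suc j)
      + complex_of_real (\<beta> (Suc j)) \<cdot>\<^sub>v v (Suc (Suc j))
      + (if j = 0 then 0\<^sub>v n else complex_of_real (\<beta> j) \<cdot>\<^sub>v v j)"
    (is "_ = ?R")
proof (rule eq_vecI)
  have vc: "v i \<in> carrier_vec n" if "1 \<le> i" "i \<le> m + 1" for i
    using L that by (auto simp: lanczos_def)
  let ?V = "lanczos_basis n v m" and ?T = "complex_mat (lanczos_tridiag \<alpha> \<beta> m)"
  let ?E = "complex_of_real (\<beta> m) \<cdot>\<^sub>m (mat_of_cols n [v (m + 1)] * mat_of_rows m [unit_vec m (m - 1)])"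
  have V: "?V \<in> carrier_mat n m" by (rule lanczos_basis_carrier)
  have T: "?T \<in> carrier_mat m m" by (simp add: lanczos_tridiag_def)
  have dec: "A * ?V = ?V * ?T + ?E"
    using L by (simp add: lanczos_def)
  have dR: "dim_vec ?R = n"
    using vc[of j] vc[of "Suc j"] vc[of "Suc (Suc j)"] j by auto
  then show "dim_vec (A *\<^sub>v v (Suc j)) = dim_vec ?R" using A by simp
  fix r assume "r < dim_vec ?R"
  then have r: "r < n" using dR by simp
  have Vi: "?V $$ (r, i) = v (Suc i) $ r" if "i < m" for i
    using col_lanczos_basis[OF that, of v n] vc[of "Suc i"] that r V by (metis Suc_leI add.commute
        carrier_matD index_col le_add1 plus_1_eq_Suc Suc_le_mono less_imp_le_nat)
  have "(A *\<^sub>v v (Suc j)) $ r = (A * ?V) $$ (r, j)"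
    using A V r j col_lanczos_basis[OF j, of v n] vc[of "Suc j"] by simp
  also have "\<dots> = (?V * ?T) $$ (r, j) + ?E $$ (r, j)"
    using V T r j unfolding dec by simp
  also have "?E $$ (r, j) = (if Suc j = m then \<beta> m * v (Suc m) $ r else 0)"
    using r j vc[of "m + 1"]
    by (auto simp: scalar_prod_def mat_of_cols_def mat_of_rows_def unit_vec_def)
  also have "(?V * ?T) $$ (r, j) = (\<Sum>i<m. v (Suc i) $ r * ?T $$ (i, j))"
    using V T r j Vi by (simp add: scalar_prod_def atLeast0LessThan)
  \<comment> \<open>In column \<open>j\<close> only rows \<open>j\<close>, \<open>j - 1\<close> and \<open>j + 1\<close> contribute. For \<open>j = 0\<close> the truncated \<open>j - 1\<close>
    coincides with \<open>j\<close>, so the inner conditional must make that summand zero.\<close>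
  also have "\<dots> = (\<Sum>i<m. (if i = j then \<alpha> (Suc j) * v (Suc j) $ r else 0)
      + (if i = j - 1 then (if j = 0 then 0 else \<beta> j * v j $ r) else 0)
      + (if i = Suc j then \<beta> (Suc j) * v (Suc (Suc j)) $ r else 0))"
    using j by (intro sum.cong) (auto simp: lanczos_tridiag_def)
  also have "\<dots> = \<alpha> (Suc j) * v (Suc j) $ r + (if j = 0 then 0 else \<beta> j * v j $ r)
      + (if Suc j < m then \<beta> (Suc j) * v (Suc (Suc j)) $ r else 0)"
    using j by (simp add: sum.distrib sum.delta)
  finally show "(A *\<^sub>v v (Suc j)) $ r = ?R $ r"
    using r j vc[of j] vc[of "Suc j"] vc[of "Suc (Suc j)"] by auto
qed

text \<open>Absence of breakdown allows division by \<open>\<beta>\<^sub>j\<close>, so each new Lanczos vector is a linear combination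
  of \<open>A v\<^sub>j\<close>, \<open>v\<^sub>j\<close> and \<open>v\<^sub>j\<^sub>-\<^sub>1\<close>.\<close>

lemma lanczos_in_krylov_space:
  assumes A: "A \<in> carrier_mat n n" and L: "lanczos n A m v1 v \<alpha> \<beta>"
    and nb: "no_breakdown m \<beta>" and i: "i \<le> m"
  shows "v (Suc i) \<in> krylov_space A v1"
  using i
proof (induction i rule: less_induct)
  case (less i)
  let ?K = "krylov_space A v1"
  show ?case
  proof (cases i)
    case 0
    then show ?thesis using L krylov_space.start by (simp add: lanczos_def)
  next
    case (Suc j)
    have j: "j < m" using Suc less.prems by simp
    \<comment> \<open>\<open>?w\<close> is the term with the previous vector, absent in the first step; \<open>?u\<close> is \<open>\<beta>\<^sub>j\<^sub>+\<^sub>1 v\<^sub>j\<^sub>+\<^sub>2\<close> by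
      the recurrence, spelled with the closure operations of the Krylov space.\<close>
    let ?w = "if j = 0 then 0\<^sub>v n else complex_of_real (\<beta> j) \<cdot>\<^sub>v v j"
    let ?u = "A *\<^sub>v v (Suc j) + (- complex_of_real (\<alpha> (Suc j))) \<cdot>\<^sub>v v (Suc j) + (- 1) \<cdot>\<^sub>v ?w"
    have vc: "v i \<in> carrier_vec n" if "1 \<le> i" "i \<le> m + 1" for i
      using L that by (auto simp: lanczos_def)
    have vj: "v (Suc j) \<in> ?K" using less Suc by simp
    have zero: "0\<^sub>v n = 0 \<cdot>\<^sub>v v (Suc j)"
      using vc[of "Suc j"] j by auto
    have w: "?w \<in> ?K"
    proof (cases j)
      case 0
      then show ?thesis using zero vj by (simp add: krylov_space.smult)
    next
      case (Suc k)
      then have "v j \<in> ?K" using less.IH[of k] \<open>i = Suc j\<close> j by simp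
      then show ?thesis using Suc by (simp add: krylov_space.smult)
    qed
    have u: "?u \<in> ?K"
      using vj w by (intro krylov_space.intros)
    have "complex_of_real (\<beta> (Suc j)) \<noteq> 0"
      using nb j by (simp add: no_breakdown_def)
    moreover have "?u = complex_of_real (\<beta> (Suc j)) \<cdot>\<^sub>v v (Suc (Suc j))"
      unfolding lanczos_three_term[OF A L j]
      using vc[of j] vc[of "Suc j"] vc[of "Suc (Suc j)"] j by (intro eq_vecI) auto
    ultimately have "v (Suc (Suc j)) = (1 / complex_of_real (\<beta> (Suc j))) \<cdot>\<^sub>v ?u"
      by (simp add: smult_smult_assoc)
    then show ?thesis unfolding Suc using krylov_space.smult[OF u] by metis
  qed
qed

section \<open>The orthogonality relations\<close>

text \<open>The inverse-free form of \<open>J\<close>-symmetry, obtained by multiplying \<open>J A J\<^sup>-\<^sup>1 = A\<^sup>T\<close> by \<open>J\<close> from the right.\<close>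

lemma J_symmetric_intertwines:
  assumes S: "structure_mat n J" and A: "J_symmetric n J A"
  shows "complex_mat J * A = A\<^sup>T * complex_mat J"
proof -
  have J: "J \<in> carrier_mat n n" using S by (simp add: structure_mat_def)
  have Ac: "A \<in> carrier_mat n n" using A by (simp add: J_symmetric_def)
  obtain K where inv: "mat_inverse J = Some K"
    and eq: "complex_mat J * A * complex_mat K = A\<^sup>T"
    using A by (auto simp: J_symmetric_def)
  have KJ: "K * J = 1\<^sub>m n" and K: "K \<in> carrier_mat n n"
    using mat_inverse(2)[OF J inv] by auto
  have cKJ: "complex_mat K * complex_mat J = 1\<^sub>m n"
    by (metis KJ of_real_hom.mat_hom_mult[OF K J] of_real_hom.mat_hom_one)
  have "A\<^sup>T * complex_mat J = complex_mat J * A * (complex_mat K * complex_mat J)"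
    unfolding eq[symmetric] using J K Ac by (intro assoc_mult_mat) auto
  then show ?thesis using cKJ J Ac by simp
qed

lemma mat_adjoint_carrier: "X \<in> carrier_mat n p \<Longrightarrow> mat_adjoint X \<in> carrier_mat p n"
  by (simp add: mat_adjoint_def mat_of_rows_def)

lemma index_mat_adjoint:
  fixes X :: "complex mat"
  assumes "X \<in> carrier_mat n p" "i < p" "r < n"
  shows "mat_adjoint X $$ (i, r) = cnj (X $$ (r, i))"
  using assms by (simp add: mat_adjoint_def mat_of_rows_index conjugate_complex_def)

text \<open>Because \<open>J\<close> is real, both outer conjugations can be pulled out, which leaves the bilinear form
  of \<open>J\<close> at two columns.\<close>

lemma adjoint_mult_real_mult_cnj:
  assumes J: "J \<in> carrier_mat n n" and X: "X \<in> carrier_mat n p" and Y: "Y \<in> carrier_mat n q"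
    and i: "i < p" and j: "j < q"
  shows "(mat_adjoint X * (complex_mat J * map_mat cnj Y)) $$ (i, j)
      = cnj (col X i \<bullet> (complex_mat J *\<^sub>v col Y j))"
  using assms mat_adjoint_carrier[OF X] by (simp add: scalar_prod_def index_mat_adjoint[OF X])

theorem corollary1:
  fixes n m :: nat
    and J :: "real mat"
    and A V W :: "complex mat"
    and v1 :: "complex vec"
    and v :: "nat \<Rightarrow> complex vec"
    and \<alpha> \<beta> :: "nat \<Rightarrow> real"
  assumes "structure_mat n J"
    and "hermitian_J_symmetric n J A"
    and "m \<ge> 1"
    and "v1 \<in> carrier_vec n"
    and "v1 \<bullet>c v1 = 1"
    and "lanczos n A m v1 v \<alpha> \<beta>"
    and "no_breakdown m \<beta>"
    and "V = lanczos_basis n v (m + 1)"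
    and "W = complex_mat J * map_mat cnj V"
  shows "mat_adjoint V * W = 0\<^sub>m (m + 1) (m + 1) \<and>
         mat_adjoint V * A * W = 0\<^sub>m (m + 1) (m + 1)"
proof -
  have J: "J \<in> carrier_mat n n" and skew: "J\<^sup>T = - J"
    using assms(1) by (auto simp: structure_mat_def)
  have sym: "J_symmetric n J A" and herm: "mat_adjoint A = A"
    using assms(2) by (auto simp: hermitian_J_symmetric_def)
  have A: "A \<in> carrier_mat n n" using sym by (simp add: J_symmetric_def)
  have V: "V \<in> carrier_mat n (m + 1)"
    unfolding assms(8) by (rule lanczos_basis_carrier)
  have cJ: "complex_mat J \<in> carrier_mat n n" using J by simp
  have cskew: "(complex_mat J)\<^sup>T = - complex_mat J"
  proof -
    have "(complex_mat J)\<^sup>T = complex_mat (J\<^sup>T)" by (rule eq_matI) auto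
    also have "\<dots> = - complex_mat J" unfolding skew by (rule eq_matI) auto
    finally show ?thesis .
  qed
  note isotropic = krylov_space_isotropic[OF A cJ cskew J_symmetric_intertwines[OF assms(1) sym] assms(4)]
  have colV: "col V i \<in> krylov_space A v1" if "i < m + 1" for i
  proof -
    have "v (Suc i) \<in> carrier_vec n" using assms(6) that by (auto simp: lanczos_def)
    then show ?thesis
      using lanczos_in_krylov_space[OF A assms(6,7)] col_lanczos_basis[OF that, of v n] that
      by (simp add: assms(8))
  qed
  \<comment> \<open>Stated for a general left factor, to be used with both \<open>V\<close> and \<open>A V\<close>.\<close>
  have null: "mat_adjoint X * W = 0\<^sub>m (m + 1) (m + 1)"
    if X: "X \<in> carrier_mat n (m + 1)" and colX: "\<And>i. i < m + 1 \<Longrightarrow> col X i \<in> krylov_space A v1" for X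
  proof (rule eq_matI)
    fix i j assume "i < dim_row (0\<^sub>m (m + 1) (m + 1))" "j < dim_col (0\<^sub>m (m + 1) (m + 1))"
    then show "(mat_adjoint X * W) $$ (i, j) = 0\<^sub>m (m + 1) (m + 1) $$ (i, j)"
      unfolding assms(9)
      using adjoint_mult_real_mult_cnj[OF J X V, of i j] isotropic[OF colX colV, of i j] by simp
  qed (use X V in \<open>simp_all add: assms(9) mat_adjoint_def\<close>)
  have AV: "A * V \<in> carrier_mat n (m + 1)" using A V by simp
  have "mat_adjoint (A * V) = mat_adjoint V * A"
  proof -
    have "mat_adjoint (A * V) = mat_adjoint V * mat_adjoint A"
      using A V AV mat_adjoint_carrier[OF A] mat_adjoint_carrier[OF V] mat_adjoint_carrier[OF AV]
      by (intro eq_matI)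
        (auto simp: scalar_prod_def index_mat_adjoint[OF A] index_mat_adjoint[OF V]
          index_mat_adjoint[OF AV] mult.commute)
    then show ?thesis by (simp only: herm)
  qed
  moreover have "col (A * V) i \<in> krylov_space A v1" if "i < m + 1" for i
    using krylov_space.mult[OF colV[OF that]] col_mult2[OF A V that] by simp
  ultimately show ?thesis
    using null[OF V colV] null[OF AV] by simp
qed

end
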